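(* Let $G$ be a simple graph whose line graph $L(G)$ is decomposable into two Hamiltonian cycles (that is, the edge set of $L(G)$ can be partitioned into the edge sets of two Hamiltonian cycles of $L(G)$). Then $G$ is either $K_{1,5}$, or the first subdivision $SG'$ of a $4$-regular graph $G'$ (not necessarily simple) that decomposes into two Hamiltonian cycles, or a Hamiltonian cubic graph.
   Context: The line graph $L(G)$ has the edges of $G$ as vertices, two being adjacent when they share an endpoint in $G$. A graph is decomposable into Hamiltonian cycles if its edge set can be partitioned into edge sets of Hamiltonian cycles. The first subdivision $SG'$ of a graph $G'$ is obtained by subdividing every edge of $G'$ into a path of length $2$.
   Formalization: The formal theorem assumes that G has no isolated vertices; without this the claim fails, e.g. for K_{1,5} plus an isolated vertex, whose line graph is K_5, and no graph of the three listed kinds has an isolated vertex. *)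

theory Defs
  imports "HOL-Library.Multiset"
begin

text \<open>
  Undirected graphs, possibly with loops and parallel edges. The two ends of an edge form a
  multiset of size 2, so that a loop at \<open>v\<close> has ends \<open>{#v, v#}\<close> and counts twice in the degree.
\<close>

record ('v, 'e) multigraph =
  verts :: "'v set"
  edges :: "'e set"
  ends :: "'e \<Rightarrow> 'v multiset"

definition wf_multigraph :: "('v, 'e) multigraph \<Rightarrow> bool" where
  "wf_multigraph G \<longleftrightarrow> finite (verts G) \<and> finite (edges G) \<and>
     (\<forall>e\<in>edges G. size (ends G e) = 2 \<and> set_mset (ends G e) \<subseteq> verts G)"

definition simple_graph :: "('v, 'e) multigraph \<Rightarrow> bool" where
  "simple_graph G \<longleftrightarrow> wf_multigraph G \<and>
     (\<forall>e\<in>edges G. \<forall>v. ends G e \<noteq> {#v, v#}) \<and> inj_on (ends G) (edges G)"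

definition degree :: "('v, 'e) multigraph \<Rightarrow> 'v \<Rightarrow> nat" where
  "degree G v = (\<Sum>e\<in>edges G. count (ends G e) v)"

definition regular :: "nat \<Rightarrow> ('v, 'e) multigraph \<Rightarrow> bool" where
  "regular k G \<longleftrightarrow> (\<forall>v\<in>verts G. degree G v = k)"

definition isomorphic :: "('v, 'e) multigraph \<Rightarrow> ('w, 'f) multigraph \<Rightarrow> bool" where
  "isomorphic G H \<longleftrightarrow> (\<exists>f g. bij_betw f (verts G) (verts H) \<and> bij_betw g (edges G) (edges H) \<and>
     (\<forall>e\<in>edges G. ends H (g e) = image_mset f (ends G e)))"

text \<open>
  \<open>hamiltonian_cycle G C\<close>: \<open>C\<close> is the edge set of a Hamiltonian cycle of \<open>G\<close>. The vertices are
  listed in cyclic order as \<open>vs\<close>, and the \<open>i\<close>-th edge joins the \<open>i\<close>-th vertex to its successor.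
  As the edges are distinct, a cycle of length 1 is a loop and a cycle of length 2 is a pair of
  parallel edges; in a simple graph the length is therefore at least 3.
\<close>

definition hamiltonian_cycle :: "('v, 'e) multigraph \<Rightarrow> 'e set \<Rightarrow> bool" where
  "hamiltonian_cycle G C \<longleftrightarrow> C \<subseteq> edges G \<and>
     (\<exists>vs es. vs \<noteq> [] \<and> distinct vs \<and> set vs = verts G \<and>
        distinct es \<and> set es = C \<and> length es = length vs \<and>
        (\<forall>i<length vs. ends G (es ! i) = {#vs ! i, vs ! (Suc i mod length vs)#}))"

definition hamiltonian :: "('v, 'e) multigraph \<Rightarrow> bool" where
  "hamiltonian G \<longleftrightarrow> (\<exists>C. hamiltonian_cycle G C)"

definition decomposes_into_two_hamiltonian_cycles :: "('v, 'e) multigraph \<Rightarrow> bool" where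
  "decomposes_into_two_hamiltonian_cycles G \<longleftrightarrow>
     (\<exists>C D. hamiltonian_cycle G C \<and> hamiltonian_cycle G D \<and> C \<inter> D = {} \<and> C \<union> D = edges G)"

text \<open>For simple \<open>G\<close> only (two parallel edges would be joined just once).\<close>

definition line_graph :: "('v, 'e) multigraph \<Rightarrow> ('e, 'e set) multigraph" where
  "line_graph G = \<lparr>verts = edges G,
     edges = {{e, f} | e f. e \<in> edges G \<and> f \<in> edges G \<and> e \<noteq> f \<and>
                set_mset (ends G e) \<inter> set_mset (ends G f) \<noteq> {}},
     ends = mset_set\<rparr>"

text \<open>
  The new vertex placed on the edge \<open>e\<close> is \<open>Inr e\<close>. The edges are the half-edges \<open>(e, v, i)\<close>
  joining \<open>v\<close> to \<open>e\<close>; the index \<open>i\<close> makes a loop at \<open>v\<close> contribute two parallel half-edges.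
\<close>

definition subdivision :: "('v, 'e) multigraph \<Rightarrow> ('v + 'e, 'e \<times> 'v \<times> nat) multigraph" where
  "subdivision G = \<lparr>verts = verts G <+> edges G,
     edges = {(e, v, i). e \<in> edges G \<and> i < count (ends G e) v},
     ends = (\<lambda>(e, v, i). {#Inl v, Inr e#})\<rparr>"

definition complete_bipartite :: "nat \<Rightarrow> nat \<Rightarrow> (nat + nat, nat \<times> nat) multigraph" where
  "complete_bipartite m n = \<lparr>verts = {..<m} <+> {..<n},
     edges = {..<m} \<times> {..<n},
     ends = (\<lambda>(i, j). {#Inl i, Inr j#})\<rparr>"

end

theory Submission imports Defs begin

text \<open>
  Every vertex of \<open>L(G)\<close> has degree 4, so the degrees of the ends of each edge of \<open>G\<close> add up to 6,
  and connectedness of \<open>L(G)\<close> makes this splitting of 6 the same for all edges. The splitting 1 + 5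
  gives a star. For 3 + 3, \<open>L(G)\<close> is an edge-disjoint union of triangles, one for each vertex, and
  each triangle has two edges in one cycle and one in the other, which singles out a perfect matching
  whose complement is a Hamiltonian cycle. For 2 + 4, \<open>L(G)\<close> consists of copies of \<open>K\<^sub>4\<close>, one
  for each degree 4 vertex, linked by one edge for each degree 2 vertex; each Hamiltonian cycle meets
  each \<open>K\<^sub>4\<close> in a path, so contracting the copies yields Hamiltonian cycles.

  A set of edges forms a Hamiltonian cycle iff it is 2-regular and connected. Connectedness is stated
  in terms of closed vertex sets, which transfers along the contractions without following the cycles.
\<close>

section \<open>Hamiltonian cycles as connected 2-regular edge sets\<close>

text \<open>This holds vacuously for an empty vertex set, so \<open>hamiltonian_cycleI\<close> asks
  for \<open>verts G \<noteq> {}\<close> separately.\<close>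

definition connected_by :: "('v, 'e) multigraph \<Rightarrow> 'e set \<Rightarrow> bool" where
  "connected_by G C \<longleftrightarrow> (\<forall>S\<subseteq>verts G. S \<noteq> {} \<longrightarrow>
     (\<forall>e\<in>C. set_mset (ends G e) \<inter> S \<noteq> {} \<longrightarrow> set_mset (ends G e) \<subseteq> S) \<longrightarrow> S = verts G)"

text \<open>Each position is an end of the steps before and after it; the pair
  \<open>{#f 0, f n#}\<close> stands in for the missing step at either extreme.\<close>

lemma sum_count_walk:
  "(\<Sum>i<n. count {#f i, f (Suc i)#} v) + count {#f 0, f n#} v = 2 * (\<Sum>i\<le>n. count {#f i#} v)"
  by (induction n) auto

lemma sum_count_nth: "(\<Sum>i<length vs. count {#vs ! i#} v) = count (mset vs) v"
  by (induction vs) (auto simp: sum.lessThan_Suc_shift simp del: sum.lessThan_Suc)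

text \<open>The added pair closes the path up, which gives each of its vertices degree 2; for
  \<open>n = 0\<close> the pair alone contributes 2. This serves both for a cycle with one edge
  removed and for a longest path.\<close>

lemma sum_count_path:
  assumes "length vs = Suc n" "distinct vs" "distinct es" "length es = n"
    "\<forall>i<n. h (es ! i) = {#vs ! i, vs ! Suc i#}"
  shows "(\<Sum>e\<in>set es. count (h e) v) + count {#vs ! 0, vs ! n#} v = (if v \<in> set vs then 2 else 0)"
proof -
  have "(\<Sum>e\<in>set es. count (h e) v) = sum_list (map (\<lambda>e. count (h e) v) es)"
    using assms(3) by (simp add: sum_list_distinct_conv_sum_set)
  also have "\<dots> = (\<Sum>i<n. count (h (es ! i)) v)"
    using assms(4) by (simp add: sum_list_sum_nth atLeast0LessThan)
  also have "\<dots> = (\<Sum>i<n. count {#vs ! i, vs ! Suc i#} v)"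
    using assms(5) by (intro sum.cong) auto
  finally have "(\<Sum>e\<in>set es. count (h e) v) + count {#vs ! 0, vs ! n#} v
      = 2 * (\<Sum>i\<le>n. count {#vs ! i#} v)"
    using sum_count_walk[of "\<lambda>i. vs ! i" v n] by simp
  also have "(\<Sum>i\<le>n. count {#vs ! i#} v) = count (mset vs) v"
    using sum_count_nth[of vs v] assms(1) by (simp add: lessThan_Suc_atMost)
  also have "\<dots> = (if v \<in> set vs then 1 else 0)"
    using assms(2) distinct_count_atmost_1 by metis
  finally show ?thesis by simp
qed

lemma hamiltonian_cycleD:
  assumes "hamiltonian_cycle G C"
  shows "C \<subseteq> edges G" "verts G \<noteq> {}" "v \<in> verts G \<Longrightarrow> (\<Sum>e\<in>C. count (ends G e) v) = 2"
    "connected_by G C"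
proof -
  obtain vs es where vs: "vs \<noteq> []" "distinct vs" "set vs = verts G"
    and es: "distinct es" "set es = C" "length es = length vs"
    and ends: "\<forall>i<length vs. ends G (es ! i) = {#vs ! i, vs ! (Suc i mod length vs)#}"
    using assms by (auto simp: hamiltonian_cycle_def)
  show "C \<subseteq> edges G" using assms by (auto simp: hamiltonian_cycle_def)
  show "verts G \<noteq> {}" using vs by auto
  obtain n where n: "length vs = Suc n" using vs(1) by (cases vs) auto
  \<comment> \<open>The last edge, from \<open>vs ! n\<close> back to \<open>vs ! 0\<close>, is
    split off so that a path remains.\<close>
  have nes: "es = butlast es @ [es ! n]"
    using es(3) n by (metis append_butlast_last_id diff_Suc_1 last_conv_nth length_0_conv nat.distinct(1))
  have "distinct (butlast es @ [es ! n])" "set (butlast es @ [es ! n]) = C"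
    using es(1,2) nes by metis+
  then have dis: "distinct (butlast es)" "es ! n \<notin> set (butlast es)" "C = insert (es ! n) (set (butlast es))"
    by auto
  have "(\<Sum>e\<in>set (butlast es). count (ends G e) v) + count {#vs ! 0, vs ! n#} v = (if v \<in> set vs then 2 else 0)"
    using n vs dis es(3) ends by (intro sum_count_path) (auto simp: nth_butlast)
  moreover have "ends G (es ! n) = {#vs ! n, vs ! 0#}"
    using ends n by simp
  ultimately show "v \<in> verts G \<Longrightarrow> (\<Sum>e\<in>C. count (ends G e) v) = 2"
    using dis(2) vs(3) by (auto simp: dis(3) split: if_splits)
  show "connected_by G C"
    unfolding connected_by_def
  proof (intro allI impI)
    fix S assume S: "S \<subseteq> verts G" "S \<noteq> {}"
      and cl: "\<forall>e\<in>C. set_mset (ends G e) \<inter> S \<noteq> {} \<longrightarrow> set_mset (ends G e) \<subseteq> S"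
    then obtain k where k: "k < length vs" "vs ! k \<in> S"
      using vs(3) by (metis in_set_conv_nth subset_iff ex_in_conv)
    \<comment> \<open>With a vertex of the cycle a closed set contains its successor, so membership
      travels all the way round from position \<open>k\<close>.\<close>
    have "vs ! ((k + j) mod length vs) \<in> S" for j
    proof (induction j)
      case (Suc j)
      let ?i = "(k + j) mod length vs"
      have i: "?i < length vs" using n by simp
      then have "es ! ?i \<in> C" using es by (metis nth_mem)
      moreover have "ends G (es ! ?i) = {#vs ! ?i, vs ! (Suc ?i mod length vs)#}"
        using ends i by blast
      ultimately have "vs ! (Suc ?i mod length vs) \<in> S" using cl Suc by auto
      then show ?case by (simp add: mod_Suc_eq)
    qed (use k in simp)
    \<comment> \<open>In the witness, adding \<open>length vs\<close> keeps the subtraction of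
      \<open>k\<close> from being truncated and vanishes modulo \<open>length vs\<close>.\<close>
    moreover have "\<exists>j. i = (k + j) mod length vs" if "i < length vs" for i
      using that k(1) by (intro exI[of _ "i + length vs - k"]) auto
    ultimately show "S = verts G"
      using S(1) vs(3) by (metis in_set_conv_nth subsetI subset_antisym)
  qed
qed

text \<open>A longest path closes up to a cycle, whose vertices then form a closed set.\<close>

lemma hamiltonian_cycleI:
  assumes wf: "wf_multigraph G" and C: "C \<subseteq> edges G" and ne: "verts G \<noteq> {}"
    and deg: "\<And>v. v \<in> verts G \<Longrightarrow> (\<Sum>e\<in>C. count (ends G e) v) = 2"
    and con: "connected_by G C"
  shows "hamiltonian_cycle G C"
proof -
  have finC: "finite C" using wf C by (auto simp: wf_multigraph_def intro: finite_subset)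
  have endsC: "size (ends G e) = 2" "set_mset (ends G e) \<subseteq> verts G" if "e \<in> C" for e
    using wf C that by (auto simp: wf_multigraph_def)
  define P where "P = (\<lambda>vs es. length vs = Suc (length es) \<and> distinct vs \<and> distinct es \<and>
    set vs \<subseteq> verts G \<and> set es \<subseteq> C \<and> (\<forall>i<length es. ends G (es ! i) = {#vs ! i, vs ! Suc i#}))"
  have "\<exists>vs. \<exists>es. P vs es"
  proof -
    obtain v where "v \<in> verts G" using ne by blast
    then have "P [v] []" by (simp add: P_def)
    then show ?thesis by blast
  qed
  moreover have "\<forall>vs. (\<exists>es. P vs es) \<longrightarrow> length vs < Suc (card (verts G))"
    using wf by (metis P_def card_mono distinct_card wf_multigraph_def le_imp_less_Suc)
  ultimately have "\<exists>vs. (\<exists>es. P vs es) \<and> (\<forall>vs'. (\<exists>es. P vs' es) \<longrightarrow> length vs' \<le> length vs)"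
    using ex_has_greatest_nat[of "\<lambda>vs. \<exists>es. P vs es" _ length] by metis
  then obtain vs where "\<exists>es. P vs es" and max: "\<And>vs' es'. P vs' es' \<Longrightarrow> length vs' \<le> length vs"
    by blast
  then obtain es where P: "P vs es" by blast
  define n where "n = length es"
  let ?x = "vs ! 0" and ?y = "vs ! n"
  have vs: "length vs = Suc n" "distinct vs" "set vs \<subseteq> verts G"
    and es: "distinct es" "set es \<subseteq> C"
    and ends: "\<And>i. i < n \<Longrightarrow> ends G (es ! i) = {#vs ! i, vs ! Suc i#}"
    using P by (auto simp: P_def n_def)
  have path: "(\<Sum>e\<in>set es. count (ends G e) v) + count {#?x, ?y#} v = (if v \<in> set vs then 2 else 0)" for v
    using vs es ends by (intro sum_count_path) (auto simp: n_def)
  have y: "?y \<in> set vs" using vs(1) by simp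
  \<comment> \<open>On the path the end \<open>?y\<close> has degree at most 1 (0 when
    \<open>n = 0\<close>), but in \<open>C\<close> it has degree 2.\<close>
  have "\<exists>e\<in>C - set es. ?y \<in># ends G e"
  proof (rule ccontr)
    assume "\<not> ?thesis"
    then have "(\<Sum>e\<in>C. count (ends G e) ?y) = (\<Sum>e\<in>set es. count (ends G e) ?y)"
      using finC es(2) by (intro sum.mono_neutral_right) (auto simp: not_in_iff)
    then show False using path[of ?y] deg[of ?y] y vs(3) by (auto split: if_splits)
  qed
  then obtain e where e: "e \<in> C" "e \<notin> set es" "?y \<in># ends G e" by blast
  obtain z where z: "ends G e = {#?y, z#}"
    using endsC(1)[OF e(1)] e(3) by (metis One_nat_def Suc_1 add_mset_remove_trivial diff_Suc_1 multi_member_split size_1_singleton_mset size_add_mset)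
  have le: "(\<Sum>e\<in>insert e (set es). count (ends G e) v) \<le> 2" if "v \<in> verts G" for v
    unfolding deg[OF that, symmetric] using finC e es by (intro sum_mono2) auto
  \<comment> \<open>Otherwise \<open>e\<close> would extend the path to \<open>z\<close>, against
    maximality.\<close>
  have "z \<in> set vs"
  proof (rule ccontr)
    assume nz: "z \<notin> set vs"
    have "ends G ((es @ [e]) ! i) = {#(vs @ [z]) ! i, (vs @ [z]) ! Suc i#}" if "i < Suc n" for i
      using that ends[of i] z vs(1) by (cases "i = n") (auto simp: nth_append n_def)
    then have "P (vs @ [z]) (es @ [e])"
      using P nz e endsC(2)[OF e(1)] z by (auto simp: P_def n_def)
    then show False using max by fastforce
  qed
  \<comment> \<open>Any other vertex of the path would get degree 3: inner vertices already have
    degree 2, and a loop at \<open>?y\<close> counts twice.\<close>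
  then have "z = ?x"
    using le[of z] path[of z] vs(3) e(2) z by (auto split: if_splits)
  then have full: "(\<Sum>e\<in>insert e (set es). count (ends G e) v) = 2" if "v \<in> set vs" for v
    using path[of v] that e(2) z by auto
  \<comment> \<open>The vertices of the path have used up their degree 2, so no further edge of
    \<open>C\<close> can touch them.\<close>
  have out: "set_mset (ends G d) \<inter> set vs = {}" if "d \<in> C - insert e (set es)" for d
  proof (rule ccontr)
    assume "\<not> ?thesis"
    then obtain v where v: "v \<in># ends G d" "v \<in> set vs" by blast
    have "(\<Sum>e\<in>insert d (insert e (set es)). count (ends G e) v) \<le> (\<Sum>e\<in>C. count (ends G e) v)"
      using finC e es that by (intro sum_mono2) auto
    then show False using that full[OF v(2)] deg[of v] v vs(3) by (auto simp: count_eq_zero_iff)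
  qed
  have "set_mset (ends G d) \<subseteq> set vs" if "d \<in> insert e (set es)" for d
  proof (cases "d = e")
    case True then show ?thesis using z y \<open>z \<in> set vs\<close> by auto
  next
    case False
    then obtain i where "i < n" "d = es ! i" using \<open>d \<in> insert e (set es)\<close>
      by (auto simp: in_set_conv_nth n_def)
    then show ?thesis using ends[of i] vs(1) by auto
  qed
  with out have vsV: "set vs = verts G"
    using con[unfolded connected_by_def, rule_format, of "set vs"] vs by (metis DiffI empty_iff list.set(1) list.size(3) nat.distinct(1) set_empty)
  have "C = insert e (set es)"
  proof (rule ccontr)
    assume "\<not> ?thesis"
    then obtain d where d: "d \<in> C - insert e (set es)" using e es by blast
    then have "set_mset (ends G d) = {}" using out[OF d] endsC(2)[of d] vsV by auto
    then show False using endsC(1)[of d] d by auto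
  qed
  moreover have "ends G ((es @ [e]) ! i) = {#vs ! i, vs ! (Suc i mod length vs)#}" if "i < length vs" for i
    using that ends[of i] z \<open>z = ?x\<close> vs(1) by (cases "i = n") (auto simp: nth_append n_def)
  moreover have "length (es @ [e]) = length vs" "distinct (es @ [e])"
    using vs e es n_def by auto
  moreover have "vs \<noteq> []" using vs(1) by auto
  ultimately show ?thesis unfolding hamiltonian_cycle_def using C vs(2) vsV
    by (intro conjI exI[of _ vs] exI[of _ "es @ [e]"]) auto
qed

section \<open>Simple graphs whose line graph splits into two Hamiltonian cycles\<close>

definition incident :: "('v, 'e) multigraph \<Rightarrow> 'v \<Rightarrow> 'e set" where
  "incident G v = {e \<in> edges G. v \<in># ends G e}"

text \<open>The edges at \<open>v\<close> form a clique of \<open>L(G)\<close>; for \<open>e\<close>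
  at \<open>v\<close> this is the degree of \<open>e\<close> in the part of \<open>C\<close> inside
  that clique.\<close>

definition local_degree :: "('v, 'e) multigraph \<Rightarrow> 'e set set \<Rightarrow> 'v \<Rightarrow> 'e \<Rightarrow> nat" where
  "local_degree G C v e = card {f \<in> incident G v. {e, f} \<in> C}"

lemma simple_graph_ends:
  assumes "simple_graph G" "e \<in> edges G" "v \<in># ends G e"
  obtains u where "ends G e = {#v, u#}" "u \<noteq> v" "u \<in> verts G" "v \<in> verts G"
proof -
  have sz: "size (ends G e) = 2" "set_mset (ends G e) \<subseteq> verts G" "ends G e \<noteq> {#v, v#}"
    using assms by (auto simp: simple_graph_def wf_multigraph_def)
  obtain u where "ends G e = {#v, u#}"
    using sz(1) assms(3)
    by (metis One_nat_def Suc_1 add_mset_remove_trivial diff_Suc_1 multi_member_split size_1_singleton_mset size_add_mset)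
  with sz that show thesis by auto
qed

lemma simple_graph_edge:
  assumes "simple_graph G" "e \<in> edges G"
  obtains u v where "ends G e = {#u, v#}" "u \<noteq> v"
proof -
  have "size (ends G e) = 2" using assms by (auto simp: simple_graph_def wf_multigraph_def)
  then obtain u where "u \<in># ends G e" by (metis multiset_nonemptyE size_empty zero_neq_numeral)
  then show thesis using simple_graph_ends[OF assms] that by metis
qed

text \<open>Both edges have the ends \<open>{#u, v#}\<close>, and there are no parallel edges. Hence
  the cliques of \<open>L(G)\<close> at two vertices share at most one element.\<close>

lemma simple_graph_edge_unique:
  assumes "simple_graph G" "e \<in> incident G u" "e \<in> incident G v" "f \<in> incident G u" "f \<in> incident G v"
    "u \<noteq> v"
  shows "e = f"
proof -
  have "ends G x = {#u, v#}" if "x \<in> incident G u" "x \<in> incident G v" for x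
    using that assms(1,6) unfolding incident_def
    by (auto elim!: simple_graph_ends[where v = u])
  then have "ends G e = ends G f" using assms(2-5) by metis
  then show ?thesis using assms(1,2,4) by (auto simp: simple_graph_def incident_def dest: inj_onD)
qed

lemma finite_incident: "simple_graph G \<Longrightarrow> finite (incident G v)"
  by (auto simp: simple_graph_def wf_multigraph_def incident_def)

text \<open>Without loops each \<open>count\<close> is 0 or 1, so degrees become
  cardinalities.\<close>

lemma sum_count_ends:
  assumes "simple_graph G" "E \<subseteq> edges G"
  shows "(\<Sum>e\<in>E. count (ends G e) v) = card (incident G v \<inter> E)"
proof -
  have "count (ends G e) v = of_bool (e \<in> incident G v)" if e: "e \<in> edges G" for e
  proof (cases "v \<in># ends G e")
    case True
    then obtain u where "ends G e = {#v, u#}" "u \<noteq> v" using simple_graph_ends[OF assms(1) e] by metis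
    then show ?thesis using e by (simp add: incident_def)
  qed (simp add: not_in_iff incident_def)
  then have "(\<Sum>e\<in>E. count (ends G e) v) = (\<Sum>e\<in>E. of_bool (e \<in> incident G v))"
    using assms(2) by (intro sum.cong) auto
  moreover have "finite E"
    using assms by (auto simp: simple_graph_def wf_multigraph_def intro: finite_subset)
  ultimately show ?thesis by (simp add: sum_of_bool_eq Int_commute)
qed

lemma degree_simple_graph: "simple_graph G \<Longrightarrow> degree G v = card (incident G v)"
  by (simp add: degree_def sum_count_ends incident_def Int_absorb2)

text \<open>The handshake lemma: a new element adds each of its neighbours twice, once from either
  side.\<close>

lemma even_sum_card_symmetric:
  assumes "finite X" "\<And>x y. R x y \<Longrightarrow> R y x" "\<And>x. \<not> R x x"
  shows "even (\<Sum>x\<in>X. card {y \<in> X. R x y})"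
  using assms(1)
proof (induction X)
  case (insert a X)
  have "card {y \<in> insert a X. R x y} = card {y \<in> X. R x y} + of_bool (R a x)" if "x \<in> X" for x
  proof -
    have "{y \<in> insert a X. R x y} = (if R a x then insert a {y \<in> X. R x y} else {y \<in> X. R x y})"
      using assms(2) by auto
    then show ?thesis using insert.hyps by simp
  qed
  moreover have "{y \<in> insert a X. R a y} = {y \<in> X. R a y}" using assms(3) by auto
  moreover have "(\<Sum>x\<in>X. of_bool (R a x)) = card {y \<in> X. R a y}"
    using insert.hyps by (simp add: sum_of_bool_eq Collect_conj_eq)
  ultimately have "(\<Sum>x\<in>insert a X. card {y \<in> insert a X. R x y}) =
     2 * card {y \<in> X. R a y} + (\<Sum>x\<in>X. card {y \<in> X. R x y})"
    using insert.hyps by (simp add: sum.distrib)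
  then show ?case using insert.IH by simp
qed simp

section \<open>Local degrees of the two cycles and the degree sum 6\<close>

locale line_graph_decomposition =
  fixes G :: "('v, 'e) multigraph" and C D :: "'e set set"
  assumes simple: "simple_graph G"
    and ham_C: "hamiltonian_cycle (line_graph G) C"
    and ham_D: "hamiltonian_cycle (line_graph G) D"
    and disjoint: "C \<inter> D = {}"
    and union: "C \<union> D = edges (line_graph G)"
begin

text \<open>The assumptions are symmetric, so interpreting the locale with the cycles exchanged
  gives each fact about \<open>C\<close> for \<open>D\<close> as well.\<close>

lemma swap: "line_graph_decomposition G D C"
  using simple ham_C ham_D disjoint union by unfold_locales auto

lemma finite_edges: "finite (edges G)"
  using simple by (auto simp: simple_graph_def wf_multigraph_def)

lemma incident_subset: "incident G v \<subseteq> edges G"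
  by (auto simp: incident_def)

lemma adjacent_iff:
  "{e, f} \<in> C \<union> D \<longleftrightarrow> e \<noteq> f \<and> (\<exists>v. e \<in> incident G v \<and> f \<in> incident G v)"
  unfolding union by (auto simp: line_graph_def incident_def doubleton_eq_iff)

lemma C_doubleton:
  assumes "A \<in> C"
  shows "A \<subseteq> edges G" "\<exists>e f. A = {e, f} \<and> e \<noteq> f"
proof -
  have "A \<in> edges (line_graph G)" using assms union by blast
  then show "A \<subseteq> edges G" "\<exists>e f. A = {e, f} \<and> e \<noteq> f" by (auto simp: line_graph_def)
qed

text \<open>Connectedness of \<open>C\<close> as an induction principle: a property of some edge of
  \<open>G\<close> that passes along \<open>C\<close> holds for all edges. It spreads local
  information over the whole graph.\<close>

lemma C_closed:
  assumes "S \<subseteq> edges G" "S \<noteq> {}" "\<And>e f. {e, f} \<in> C \<Longrightarrow> e \<in> S \<Longrightarrow> f \<in> S"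
  shows "S = edges G"
proof -
  have "set_mset (ends (line_graph G) A) \<subseteq> S"
    if A: "A \<in> C" and ne: "set_mset (ends (line_graph G) A) \<inter> S \<noteq> {}" for A
  proof -
    obtain e f where "A = {e, f}" using C_doubleton(2)[OF A] by blast
    then show ?thesis using A ne assms(3)[of e f] assms(3)[of f e]
      by (auto simp: line_graph_def insert_commute)
  qed
  then show ?thesis
    using hamiltonian_cycleD(4)[OF ham_C] assms(1,2) unfolding connected_by_def
    by (simp add: line_graph_def)
qed

lemma edges_nonempty: "edges G \<noteq> {}"
  using hamiltonian_cycleD(2)[OF ham_C] by (simp add: line_graph_def)

text \<open>The neighbours \<open>f\<close> correspond bijectively to the members
  \<open>{e, f}\<close> of \<open>C\<close>, and a cycle is 2-regular.\<close>

lemma card_C_neighbours: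
  assumes "e \<in> edges G"
  shows "card {f. {e, f} \<in> C} = 2"
proof -
  have "C \<subseteq> Pow (edges G)" using C_doubleton(1) by blast
  then have fin: "finite C" using finite_edges finite_subset by blast
  have "bij_betw (\<lambda>f. {e, f}) {f. {e, f} \<in> C} {A \<in> C. e \<in> A}"
    unfolding bij_betw_def
  proof
    show "inj_on (\<lambda>f. {e, f}) {f. {e, f} \<in> C}" by (auto simp: inj_on_def doubleton_eq_iff)
    have "A \<in> (\<lambda>f. {e, f}) ` {f. {e, f} \<in> C}" if "A \<in> C" "e \<in> A" for A
      using C_doubleton(2)[OF that(1)] that by (auto simp: insert_commute)
    then show "(\<lambda>f. {e, f}) ` {f. {e, f} \<in> C} = {A \<in> C. e \<in> A}" by auto
  qed
  then have "card {f. {e, f} \<in> C} = card {A \<in> C. e \<in> A}" by (rule bij_betw_same_card)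
  also have "\<dots> = (\<Sum>A\<in>C. of_bool (e \<in> A))"
    using fin by (simp add: sum_of_bool_eq Collect_conj_eq)
  also have "\<dots> = (\<Sum>A\<in>C. count (ends (line_graph G) A) e)"
    using C_doubleton(2) by (intro sum.cong) (fastforce simp: line_graph_def)+
  also have "\<dots> = 2"
    using hamiltonian_cycleD(3)[OF ham_C] assms by (simp add: line_graph_def)
  finally show ?thesis .
qed

text \<open>Each of the two neighbours of \<open>e\<close> on \<open>C\<close> shares exactly one
  end with \<open>e\<close>, so they are divided between the cliques at \<open>u\<close> and
  \<open>v\<close>.\<close>

lemma local_degree_ends:
  assumes e: "e \<in> edges G" "ends G e = {#u, v#}"
  shows "local_degree G C u e + local_degree G C v e = 2"
proof -
  have uv: "u \<noteq> v" using simple e by (auto simp: simple_graph_def)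
  have e_in: "e \<in> incident G u" "e \<in> incident G v" using e by (auto simp: incident_def)
  have "{f. {e, f} \<in> C} = {f \<in> incident G u. {e, f} \<in> C} \<union> {f \<in> incident G v. {e, f} \<in> C}"
    using adjacent_iff[of e] e by (fastforce simp: incident_def)
  moreover have "{f \<in> incident G u. {e, f} \<in> C} \<inter> {f \<in> incident G v. {e, f} \<in> C} = {}"
    using adjacent_iff[of e] simple_graph_edge_unique[OF simple e_in _ _ uv] by blast
  ultimately have "card {f. {e, f} \<in> C} = local_degree G C u e + local_degree G C v e"
    unfolding local_degree_def using finite_incident[OF simple]
    by (metis (no_types, lifting) card_Un_disjoint finite_Un finite_subset mem_Collect_eq subsetI)
  then show ?thesis using card_C_neighbours[OF e(1)] by simp
qed

text \<open>Every other edge at \<open>v\<close> is joined to \<open>e\<close> in exactly one of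
  \<open>C\<close> and \<open>D\<close>; \<open>Suc\<close> accounts for \<open>e\<close>
  itself.\<close>

lemma local_degree_C_D:
  assumes "e \<in> incident G v"
  shows "Suc (local_degree G C v e + local_degree G D v e) = degree G v"
proof -
  have "incident G v - {e} = {f \<in> incident G v. {e, f} \<in> C} \<union> {f \<in> incident G v. {e, f} \<in> D}"
    using adjacent_iff[of e] assms by blast
  moreover have "{f \<in> incident G v. {e, f} \<in> C} \<inter> {f \<in> incident G v. {e, f} \<in> D} = {}"
    using disjoint by blast
  ultimately have "card (incident G v - {e}) = local_degree G C v e + local_degree G D v e"
    using finite_incident[OF simple, of v] by (simp add: local_degree_def card_Un_disjoint)
  moreover have "card (incident G v) = Suc (card (incident G v - {e}))"
    using finite_incident[OF simple] assms by (metis card.remove)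
  ultimately show ?thesis by (simp add: degree_simple_graph[OF simple])
qed

text \<open>The four local degrees of \<open>e\<close>, over both ends and both cycles, add up to 4,
  and \<open>e\<close> itself counts once at each end.\<close>

lemma degree_ends:
  assumes e: "e \<in> edges G" "ends G e = {#u, v#}"
  shows "degree G u + degree G v = 6"
proof -
  interpret DC: line_graph_decomposition G D C by (rule swap)
  have "e \<in> incident G u" "e \<in> incident G v" using e by (auto simp: incident_def)
  from this[THEN local_degree_C_D] local_degree_ends[OF e] DC.local_degree_ends[OF e]
  show ?thesis by linarith
qed

lemma even_local_degree: "even (\<Sum>e\<in>incident G v. local_degree G C v e)"
proof -
  have "{e} \<notin> C" for e using C_doubleton(2)[of "{e}"] by (auto simp: doubleton_eq_iff)
  moreover have "{f, e} \<in> C" if "{e, f} \<in> C" for e f using that by (simp add: insert_commute)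
  ultimately show ?thesis
    unfolding local_degree_def by (intro even_sum_card_symmetric finite_incident[OF simple]) auto
qed

text \<open>Otherwise \<open>C\<close> would never leave the clique at \<open>v\<close>.\<close>

lemma local_degree_not_all_2:
  assumes "degree G v \<le> 4" "e0 \<in> incident G v"
  shows "\<exists>e\<in>incident G v. local_degree G C v e \<noteq> 2"
proof (rule ccontr)
  assume two: "\<not> ?thesis"
  have "incident G v = edges G"
  proof (rule C_closed)
    fix e f assume ef: "{e, f} \<in> C" "e \<in> incident G v"
    then have card: "card {f. {e, f} \<in> C} = 2" using card_C_neighbours incident_subset by blast
    \<comment> \<open>Both \<open>C\<close>-neighbours of \<open>e\<close> are already found at
      \<open>v\<close>.\<close>
    have "{f \<in> incident G v. {e, f} \<in> C} = {f. {e, f} \<in> C}"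
    proof (rule card_subset_eq)
      show "finite {f. {e, f} \<in> C}" using card by (intro card_ge_0_finite) simp
      show "card {f \<in> incident G v. {e, f} \<in> C} = card {f. {e, f} \<in> C}"
        using two ef(2) card by (auto simp: local_degree_def)
    qed auto
    then show "f \<in> incident G v" using ef(1) by blast
  qed (use assms incident_subset in auto)
  moreover obtain u where u: "ends G e0 = {#v, u#}" "u \<noteq> v" and e0: "e0 \<in> edges G"
    using assms(2) simple_graph_ends[OF simple] unfolding incident_def by blast
  ultimately have "incident G u \<subseteq> incident G v" using incident_subset by metis
  moreover have "e0 \<in> incident G u" using u e0 by (auto simp: incident_def)
  \<comment> \<open>The other end \<open>u\<close> then has degree 1, which would force degree 5 at
    \<open>v\<close>.\<close>
  ultimately have "incident G u = {e0}"
    using simple_graph_edge_unique[OF simple _ _ _ _ u(2)] assms(2) by blast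
  then show False using degree_ends[OF e0 u(1)] assms(1) degree_simple_graph[OF simple, of u] by simp
qed

section \<open>The star\<close>

text \<open>By the degree sum 6 every neighbour of \<open>c\<close> is a leaf. A step of
  \<open>C\<close> from an edge at \<open>c\<close> therefore stays at \<open>c\<close>, so by
  connectedness there are no other edges; without isolated vertices, \<open>c\<close> and the leaves
  are all vertices.\<close>

lemma star:
  assumes iso: "\<forall>v\<in>verts G. degree G v > 0" and c: "c \<in> verts G" "degree G c = 5"
  shows "isomorphic G (complete_bipartite 1 5)"
proof -
  let ?I = "incident G c"
  have card: "card ?I = 5" using c degree_simple_graph[OF simple] by metis
  have "\<exists>u. e \<in> ?I \<longrightarrow> ends G e = {#c, u#} \<and> u \<noteq> c \<and> u \<in> verts G \<and> incident G u = {e}" for e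
  proof (cases "e \<in> ?I")
    case True
    then have e: "e \<in> edges G" "c \<in># ends G e" by (auto simp: incident_def)
    obtain u where u: "ends G e = {#c, u#}" "u \<noteq> c" "u \<in> verts G"
      using simple_graph_ends[OF simple e] by metis
    have "card (incident G u) = 1"
      using degree_ends[OF e(1) u(1)] c(2) degree_simple_graph[OF simple, of u] by linarith
    moreover have "e \<in> incident G u" using e u by (auto simp: incident_def)
    ultimately have "incident G u = {e}" by (auto simp: card_1_singleton_iff)
    with u show ?thesis by blast
  qed simp
  then obtain leaf where leaf: "\<And>e. e \<in> ?I \<Longrightarrow> ends G e = {#c, leaf e#} \<and> leaf e \<noteq> c \<and>
      leaf e \<in> verts G \<and> incident G (leaf e) = {e}"
    by metis
  have I: "?I = edges G"
  proof (rule C_closed)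
    show "?I \<noteq> {}" using card by auto
    fix e f assume ef: "{e, f} \<in> C" "e \<in> ?I"
    then obtain v where v: "e \<in> incident G v" "f \<in> incident G v" "e \<noteq> f"
      using adjacent_iff[of e f] by blast
    then have "v = c \<or> v = leaf e" using leaf[OF ef(2)] by (auto simp: incident_def)
    then show "f \<in> ?I" using v leaf[OF ef(2)] by auto
  qed (rule incident_subset)
  have inj: "inj_on leaf (edges G)"
    using leaf unfolding I inj_on_def by (metis singleton_inject)
  have verts: "verts G = insert c (leaf ` edges G)"
  proof
    show "verts G \<subseteq> insert c (leaf ` edges G)"
    proof
      fix v assume "v \<in> verts G"
      then have "card (incident G v) > 0" using iso degree_simple_graph[OF simple] by metis
      then obtain e where "e \<in> incident G v" by (metis card_gt_0_iff ex_in_conv)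
      then have "e \<in> edges G" "v \<in># ends G e" by (auto simp: incident_def)
      then show "v \<in> insert c (leaf ` edges G)" using leaf[of e] I by auto
    qed
    show "insert c (leaf ` edges G) \<subseteq> verts G" using c leaf I by auto
  qed
  obtain h where h: "bij_betw h (edges G) {..<5::nat}"
    using card I finite_edges by (metis ex_bij_betw_finite_nat atLeast0LessThan)
  define f where "f = (\<lambda>v. if v = c then Inl 0 else Inr (h (inv_into (edges G) leaf v)) :: nat + nat)"
  have f: "f c = Inl 0" "\<And>e. e \<in> edges G \<Longrightarrow> f (leaf e) = Inr (h e)"
    using leaf I inj by (auto simp: f_def)
  define g where "g = (\<lambda>e. (0 :: nat, h e))"
  have "bij_betw f (verts G) (verts (complete_bipartite 1 5))"
    unfolding bij_betw_def
  proof
    show "inj_on f (verts G)"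
      unfolding verts inj_on_def using f h by (auto simp: bij_betw_def inj_on_def)
    have "f ` verts G = insert (Inl 0) (Inr ` h ` edges G)"
      unfolding verts using f by (auto simp: image_image)
    then show "f ` verts G = verts (complete_bipartite 1 5)"
      using h by (auto simp: bij_betw_def complete_bipartite_def)
  qed
  moreover have "bij_betw g (edges G) (edges (complete_bipartite 1 5))"
    using h by (auto simp: bij_betw_def complete_bipartite_def g_def inj_on_def)
  moreover have "ends (complete_bipartite 1 5) (g e) = image_mset f (ends G e)" if "e \<in> edges G" for e
    using f leaf[of e] that I by (auto simp: complete_bipartite_def g_def)
  ultimately show ?thesis unfolding isomorphic_def by blast
qed

subsection \<open>Cubic graphs\<close>

lemma local_degree_triple:
  assumes "incident G v = {a, b, c}" "distinct [a, b, c]"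
  shows "local_degree G C v a = of_bool ({a, b} \<in> C) + of_bool ({a, c} \<in> C)"
proof -
  have "{a} \<notin> C" using C_doubleton(2)[of "{a}"] by (auto simp: doubleton_eq_iff)
  then have "{f \<in> incident G v. {a, f} \<in> C} =
      (if {a, b} \<in> C then {b} else {}) \<union> (if {a, c} \<in> C then {c} else {})"
    using assms by auto
  then show ?thesis using assms(2) by (auto simp: local_degree_def)
qed

text \<open>Neither cycle contains the whole triangle at \<open>v\<close>, so \<open>C\<close>
  contains one or two of its sides. With two sides \<open>b\<close> is their common element, of
  local degree 2; with one side \<open>b\<close> is the element opposite to it, of local degree
  0.\<close>

lemma cubic_middle_edge:
  assumes "degree G v = 3"
  obtains b where "b \<in> incident G v" "local_degree G C v b \<noteq> 1"
    "\<And>e. e \<in> incident G v \<Longrightarrow> e \<noteq> b \<Longrightarrow> local_degree G C v e = 1"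
proof -
  interpret DC: line_graph_decomposition G D C by (rule swap)
  obtain a b c where I: "incident G v = {a, b, c}" and dis: "distinct [a, b, c]"
    using assms degree_simple_graph[OF simple, of v] by (auto simp: card_3_iff)
  have "local_degree G C v a = of_bool ({a, b} \<in> C) + of_bool ({a, c} \<in> C)"
    "local_degree G C v b = of_bool ({a, b} \<in> C) + of_bool ({b, c} \<in> C)"
    "local_degree G C v c = of_bool ({a, c} \<in> C) + of_bool ({b, c} \<in> C)"
    using local_degree_triple[of v a b c] local_degree_triple[of v b a c]
      local_degree_triple[of v c a b] I dis by (auto simp: insert_commute)
  moreover have "\<exists>e\<in>incident G v. local_degree G C v e \<noteq> 2"
    using assms I by (intro local_degree_not_all_2) auto
  \<comment> \<open>Local degree 0 in \<open>C\<close> at all three edges would mean local degree 2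
    in \<open>D\<close> at all of them.\<close>
  moreover have "\<exists>e\<in>incident G v. local_degree G C v e \<noteq> 0"
    using DC.local_degree_not_all_2[of v a] local_degree_C_D[of _ v] assms I by fastforce
  ultimately have "(local_degree G C v a \<noteq> 1 \<and> local_degree G C v b = 1 \<and> local_degree G C v c = 1)
    \<or> (local_degree G C v b \<noteq> 1 \<and> local_degree G C v a = 1 \<and> local_degree G C v c = 1)
    \<or> (local_degree G C v c \<noteq> 1 \<and> local_degree G C v a = 1 \<and> local_degree G C v b = 1)"
    unfolding I by (cases "{a, b} \<in> C"; cases "{a, c} \<in> C"; cases "{b, c} \<in> C") auto
  then show thesis using that[of a] that[of b] that[of c] I by fastforce
qed

lemma ex_incident:
  assumes "\<forall>v\<in>verts G. degree G v > 0" "v \<in> verts G"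
  obtains e where "e \<in> incident G v"
  using assms degree_simple_graph[OF simple] by (metis card_gt_0_iff ex_in_conv)

text \<open>The degree sum 6 passes degree 3 from one end of an edge to the other, and
  \<open>C\<close> passes it on to every edge.\<close>

lemma regular_3:
  assumes iso: "\<forall>v\<in>verts G. degree G v > 0" and v0: "v0 \<in> verts G" "degree G v0 = 3"
  shows "regular 3 G"
proof -
  have other: "degree G u = 3" if "e \<in> incident G v" "degree G v = 3" "u \<in># ends G e" for e u v
  proof -
    have e: "e \<in> edges G" "v \<in># ends G e" using that(1) by (auto simp: incident_def)
    then obtain w where w: "ends G e = {#v, w#}" using simple_graph_ends[OF simple] by metis
    then show ?thesis using degree_ends[OF e(1) w] that by auto
  qed
  have "{e \<in> edges G. \<forall>v\<in>#ends G e. degree G v = 3} = edges G"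
  proof (rule C_closed)
    obtain e where "e \<in> incident G v0" using ex_incident[OF iso v0(1)] .
    with other[OF _ v0(2)] show "{e \<in> edges G. \<forall>v\<in>#ends G e. degree G v = 3} \<noteq> {}"
      using incident_subset by blast
    fix e f assume ef: "{e, f} \<in> C" "e \<in> {e \<in> edges G. \<forall>v\<in>#ends G e. degree G v = 3}"
    then obtain v where v: "e \<in> incident G v" "f \<in> incident G v" using adjacent_iff[of e f] by blast
    then have "degree G v = 3" using ef by (auto simp: incident_def)
    with other[OF v(2)] show "f \<in> {e \<in> edges G. \<forall>v\<in>#ends G e. degree G v = 3}"
      using v incident_subset by blast
  qed auto
  moreover have "\<exists>e\<in>edges G. v \<in># ends G e" if "v \<in> verts G" for v
    using ex_incident[OF iso that] unfolding incident_def by blast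
  ultimately have "degree G v = 3" if "v \<in> verts G" for v
    using that by blast
  then show ?thesis by (simp add: regular_def)
qed

text \<open>
  At every vertex there is exactly one edge whose two neighbours there lie on the same cycle. These
  edges form a perfect matching, and skipping them in \<open>C\<close> leaves a closed walk through all other
  edges; so the complement \<open>F\<close> of the matching is 2-regular and connected.
\<close>

lemma cubic_hamiltonian:
  assumes "regular 3 G"
  shows "hamiltonian G"
proof -
  define F where "F = {e \<in> edges G. \<forall>v\<in>#ends G e. local_degree G C v e = 1}"
  have F: "F \<subseteq> edges G" by (auto simp: F_def)
  \<comment> \<open>The local degrees at the two ends add up to 2, so one of them is 1 iff both
    are.\<close>
  have F_iff: "e \<in> F \<longleftrightarrow> local_degree G C v e = 1" if "e \<in> incident G v" for e v
  proof -
    have e: "e \<in> edges G" "v \<in># ends G e" using that by (auto simp: incident_def)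
    then obtain w where "ends G e = {#v, w#}" using simple_graph_ends[OF simple] by metis
    with e show ?thesis using local_degree_ends[OF e(1), of v w] by (auto simp: F_def)
  qed
  have deg3: "degree G v = 3" if "v \<in> verts G" for v using that assms by (simp add: regular_def)
  have in_verts: "v \<in> verts G" if "e \<in> edges G" "v \<in># ends G e" for e v
    using simple that by (auto simp: simple_graph_def wf_multigraph_def)
  have card_F: "card (incident G v \<inter> F) = 2" if v: "v \<in> verts G" for v
  proof -
    obtain b where b: "b \<in> incident G v" "local_degree G C v b \<noteq> 1"
      "\<And>e. e \<in> incident G v \<Longrightarrow> e \<noteq> b \<Longrightarrow> local_degree G C v e = 1"
      using cubic_middle_edge[OF deg3[OF v]] by blast
    then have "incident G v \<inter> F = incident G v - {b}" using F_iff by blast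
    then show ?thesis
      using deg3[OF v] b(1) finite_incident[OF simple] by (simp add: degree_simple_graph[OF simple])
  qed
  have "connected_by G F"
    unfolding connected_by_def
  proof (intro allI impI)
    fix S assume S: "S \<subseteq> verts G" "S \<noteq> {}"
      and cl: "\<forall>e\<in>F. set_mset (ends G e) \<inter> S \<noteq> {} \<longrightarrow> set_mset (ends G e) \<subseteq> S"
    have F_in: "\<exists>e\<in>F. e \<in> incident G v" if "v \<in> verts G" for v
      using card_F[OF that] by (metis Int_iff card.empty ex_in_conv zero_neq_numeral)
    \<comment> \<open>\<open>X\<close> lifts \<open>S\<close> to the edges of \<open>G\<close>. An
      edge outside \<open>F\<close> has local degree 2 at one end and 0 at the other;
      \<open>C\<close> traverses it inside the clique at the first, and that end decides.\<close>
    define X where "X = {e \<in> edges G. if e \<in> F then set_mset (ends G e) \<subseteq> S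
      else \<exists>v\<in>#ends G e. v \<in> S \<and> local_degree G C v e = 2}"
    \<comment> \<open>Whenever \<open>C\<close> takes a step from \<open>e\<close> inside the clique
      at \<open>v\<close>, membership of \<open>e\<close> in \<open>X\<close> depends on
      \<open>v\<close> only. Both partners of the step thus get the same answer.\<close>
    have X_iff: "e \<in> X \<longleftrightarrow> v \<in> S" if e: "e \<in> incident G v" "f \<in> incident G v" "{e, f} \<in> C" for e f v
    proof -
      have e': "e \<in> edges G" "v \<in># ends G e" using e by (auto simp: incident_def)
      show ?thesis
      proof (cases "e \<in> F")
        case True
        then show ?thesis using cl e' by (auto simp: X_def)
      next
        case False
        obtain w where w: "ends G e = {#v, w#}" using e' simple_graph_ends[OF simple] by metis
        have "local_degree G C v e \<noteq> 0"
          using e finite_incident[OF simple] by (auto simp: local_degree_def)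
        then have "local_degree G C v e = 2" "local_degree G C w e = 0"
          using local_degree_ends[OF e'(1) w] F_iff[OF e(1)] False by auto
        then show ?thesis using False e'(1) w by (auto simp: X_def)
      qed
    qed
    have "X = edges G"
    proof (rule C_closed)
      show "X \<subseteq> edges G" by (auto simp: X_def)
      obtain v e where "v \<in> S" "e \<in> F" "e \<in> incident G v" using S F_in by blast
      then have "e \<in> X" using cl F by (auto simp: X_def incident_def)
      then show "X \<noteq> {}" by blast
      fix e f assume ef: "{e, f} \<in> C" "e \<in> X"
      then obtain v where "e \<in> incident G v" "f \<in> incident G v" using adjacent_iff[of e f] by blast
      then show "f \<in> X" using X_iff[of e v f] X_iff[of f v e] ef by (simp add: insert_commute)
    qed
    have "v \<in> S" if v: "v \<in> verts G" for v
    proof -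
      obtain e where e: "e \<in> F" "v \<in># ends G e" using F_in[OF v] by (auto simp: incident_def)
      then have "e \<in> X" using F \<open>X = edges G\<close> by blast
      then show ?thesis using e by (auto simp: X_def)
    qed
    then show "S = verts G" using S by blast
  qed
  moreover have "verts G \<noteq> {}"
  proof -
    obtain e where "e \<in> edges G" using edges_nonempty by blast
    then show ?thesis using simple_graph_edge[OF simple] in_verts by (metis empty_iff union_single_eq_member)
  qed
  ultimately have "hamiltonian_cycle G F"
    using F card_F simple sum_count_ends[OF simple F]
    by (intro hamiltonian_cycleI) (auto simp: simple_graph_def)
  then show ?thesis by (auto simp: hamiltonian_def)
qed

end

section \<open>Degrees 2 and 4\<close>

text \<open>The inverse of subdividing: a vertex of degree 2 becomes the edge between the far ends
  of its two edges. Several such vertices may have the same far ends, which gives parallel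
  edges.\<close>

definition contraction :: "('v, 'e) multigraph \<Rightarrow> ('e \<Rightarrow> 'v) \<Rightarrow> ('v, 'v) multigraph" where
  "contraction G hi = \<lparr>verts = {v \<in> verts G. degree G v = 4}, edges = {v \<in> verts G. degree G v = 2},
     ends = (\<lambda>w. image_mset hi (mset_set (incident G w)))\<rparr>"

locale subdivided_decomposition = line_graph_decomposition G C D
  for G :: "('v, 'e) multigraph" and C D +
  fixes lo hi :: "'e \<Rightarrow> 'v"
  assumes lo_hi: "e \<in> edges G \<Longrightarrow> ends G e = {#lo e, hi e#} \<and> degree G (lo e) = 2 \<and> degree G (hi e) = 4"
    and no_isolated: "\<forall>v\<in>verts G. degree G v > 0"
begin

lemma swap_subdivided: "subdivided_decomposition G D C lo hi"
  using swap lo_hi no_isolated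
  by (auto simp: subdivided_decomposition_def subdivided_decomposition_axioms_def)

lemma lo_hi_verts: "e \<in> edges G \<Longrightarrow> lo e \<in> verts G" "e \<in> edges G \<Longrightarrow> hi e \<in> verts G"
  using simple lo_hi by (force simp: simple_graph_def wf_multigraph_def)+

lemma incident_lo: "degree G w = 2 \<Longrightarrow> incident G w = {e \<in> edges G. lo e = w}"
  and incident_hi: "degree G v = 4 \<Longrightarrow> incident G v = {e \<in> edges G. hi e = v}"
  using lo_hi by (fastforce simp: incident_def)+

lemma edge_eqI: "e \<in> edges G \<Longrightarrow> f \<in> edges G \<Longrightarrow> lo e = lo f \<Longrightarrow> hi e = hi f \<Longrightarrow> e = f"
  using simple lo_hi unfolding simple_graph_def by (metis inj_onD)

section \<open>The contraction as a 4-regular multigraph\<close>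

abbreviation "G' \<equiv> contraction G hi"

lemma wf_contraction: "wf_multigraph G'"
  unfolding wf_multigraph_def
proof (intro conjI ballI)
  fix w assume "w \<in> edges G'"
  then have w: "degree G w = 2" by (auto simp: contraction_def)
  then show "size (ends G' w) = 2"
    by (simp add: contraction_def degree_simple_graph[OF simple])
  show "set_mset (ends G' w) \<subseteq> verts G'"
    using w finite_edges lo_hi lo_hi_verts by (auto simp: contraction_def incident_lo)
qed (use simple in \<open>auto simp: contraction_def simple_graph_def wf_multigraph_def\<close>)

text \<open>This multiplicity bounds the index of the half-edges in \<open>subdivision\<close>, so
  it ties them to edges of \<open>G\<close>.\<close>

lemma count_contraction:
  assumes "degree G w = 2"
  shows "count (ends G' w) v = card {e \<in> edges G. lo e = w \<and> hi e = v}"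
proof -
  have "hi -` {v} \<inter> incident G w = {e \<in> edges G. lo e = w \<and> hi e = v}"
    using incident_lo[OF assms] by auto
  then show ?thesis
    using finite_incident[OF simple, of w]
    by (auto simp: contraction_def count_image_mset incident_lo[OF assms])
qed

text \<open>The edges at \<open>v\<close> are sorted by their ends of degree 2. For
  \<open>W = edges G'\<close> this yields 4-regularity, for \<open>W = links\<close> the degree
  condition of a Hamiltonian cycle.\<close>

lemma sum_count_contraction:
  assumes "W \<subseteq> edges G'" "degree G v = 4"
  shows "(\<Sum>w\<in>W. count (ends G' w) v) = card {e \<in> incident G v. lo e \<in> W}"
proof -
  have fin: "finite W" using assms wf_contraction by (auto simp: wf_multigraph_def intro: finite_subset)
  have "{e \<in> incident G v. lo e \<in> W} = (\<Union>w\<in>W. {e \<in> edges G. lo e = w \<and> hi e = v})"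
    using incident_hi[OF assms(2)] by auto
  also have "card \<dots> = (\<Sum>w\<in>W. card {e \<in> edges G. lo e = w \<and> hi e = v})"
    using fin finite_edges by (intro card_UN_disjoint) auto
  also have "\<dots> = (\<Sum>w\<in>W. count (ends G' w) v)"
    using assms(1) count_contraction by (intro sum.cong) (auto simp: contraction_def)
  finally show ?thesis by simp
qed

lemma lo_in_edges: "e \<in> edges G \<Longrightarrow> lo e \<in> edges G'"
  using lo_hi lo_hi_verts by (auto simp: contraction_def)

lemma regular_contraction: "regular 4 G'"
  unfolding regular_def
proof
  fix v assume "v \<in> verts G'"
  then have v: "degree G v = 4" by (auto simp: contraction_def)
  have "{e \<in> incident G v. lo e \<in> edges G'} = incident G v"
    using lo_in_edges incident_subset by blast
  then show "degree G' v = 4"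
    using sum_count_contraction[OF order_refl v] v
    by (simp add: degree_def[of G'] degree_simple_graph[OF simple])
qed

lemma degree_cases:
  assumes "v \<in> verts G"
  shows "degree G v = 2 \<or> degree G v = 4"
proof -
  obtain e where "e \<in> incident G v" using ex_incident[OF no_isolated assms] .
  then show ?thesis using lo_hi by (auto simp: incident_def)
qed

lemma isomorphic_subdivision: "isomorphic G (subdivision G')"
proof -
  define f where "f = (\<lambda>v. if degree G v = 4 then Inl v else Inr v :: 'v + 'v)"
  \<comment> \<open>The edge \<open>e\<close> becomes the half-edge of \<open>lo e\<close> at
    \<open>hi e\<close>. The index is always 0, since simplicity of \<open>G\<close> leaves no loops
    in \<open>G'\<close>.\<close>
  define g where "g = (\<lambda>e. (lo e, hi e, 0 :: nat))"
  have card: "card {e \<in> edges G. lo e = w \<and> hi e = v} \<le> 1" for w v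
    using finite_edges edge_eqI by (subst card_le_Suc0_iff_eq[simplified One_nat_def[symmetric]]) auto
  have "bij_betw f (verts G) (verts (subdivision G'))"
    using degree_cases
    by (auto simp: bij_betw_def inj_on_def f_def subdivision_def contraction_def split: if_splits)
  moreover have "bij_betw g (edges G) (edges (subdivision G'))"
    unfolding bij_betw_def
  proof
    show "inj_on g (edges G)" using edge_eqI by (auto simp: inj_on_def g_def)
    show "g ` edges G = edges (subdivision G')"
    proof (intro set_eqI iffI)
      fix x assume "x \<in> g ` edges G"
      then obtain e where e: "e \<in> edges G" "x = g e" by blast
      then have "{e' \<in> edges G. lo e' = lo e \<and> hi e' = hi e} \<noteq> {}" by blast
      then have "0 < card {e' \<in> edges G. lo e' = lo e \<and> hi e' = hi e}"
        using finite_edges by (simp add: card_gt_0_iff)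
      then show "x \<in> edges (subdivision G')"
        using e lo_in_edges[OF e(1)] count_contraction[of "lo e"] lo_hi[OF e(1)]
        by (simp add: subdivision_def g_def)
    next
      fix x assume "x \<in> edges (subdivision G')"
      then obtain w v i where x: "x = (w, v, i)" "w \<in> edges G'" "i < count (ends G' w) v"
        by (auto simp: subdivision_def)
      then have i: "i < card {e \<in> edges G. lo e = w \<and> hi e = v}"
        using count_contraction by (simp add: contraction_def)
      then have "{e \<in> edges G. lo e = w \<and> hi e = v} \<noteq> {}" by force
      moreover have "i = 0" using i card[of w v] by linarith
      ultimately show "x \<in> g ` edges G" using x(1) by (auto simp: g_def)
    qed
  qed
  moreover have "ends (subdivision G') (g e) = image_mset f (ends G e)" if "e \<in> edges G" for e
    using lo_hi[OF that] by (simp add: subdivision_def g_def f_def add_mset_commute)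
  ultimately show ?thesis unfolding isomorphic_def by blast
qed

section \<open>The two Hamiltonian cycles of the contraction\<close>

text \<open>For \<open>w\<close> of degree 2, \<open>incident G w\<close> is a pair of edges and so
  is itself the edge of \<open>L(G)\<close> linking two 4-cliques; those traversed by
  \<open>C\<close> are collected.\<close>

definition links :: "'v set" where
  "links = {w \<in> edges G'. incident G w \<in> C}"

lemma incident_lo_doubleton:
  assumes "e \<in> edges G"
  obtains f where "incident G (lo e) = {e, f}" "f \<noteq> e"
proof -
  have "card (incident G (lo e)) = 2" "e \<in> incident G (lo e)"
    using lo_hi[OF assms] assms degree_simple_graph[OF simple] by (auto simp: incident_def)
  then obtain x y where "incident G (lo e) = {x, y}" "x \<noteq> y" "e = x \<or> e = y"
    by (auto simp: card_2_iff)
  then show thesis using that[of x] that[of y] by (auto simp: insert_commute)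
qed

text \<open>At \<open>lo e\<close> there is only one other edge, so \<open>C\<close> spends one of
  its two steps at \<open>e\<close> there if the link is in \<open>C\<close>, and none
  otherwise.\<close>

lemma local_degree_hi:
  assumes "e \<in> edges G"
  shows "local_degree G C (hi e) e + of_bool (lo e \<in> links) = 2"
proof -
  obtain f where f: "incident G (lo e) = {e, f}" "f \<noteq> e" using incident_lo_doubleton[OF assms] .
  have "{e} \<notin> C" using C_doubleton(2)[of "{e}"] by (auto simp: doubleton_eq_iff)
  then have "{x \<in> incident G (lo e). {e, x} \<in> C} = (if lo e \<in> links then {f} else {})"
    using f lo_in_edges[OF assms] by (auto simp: links_def)
  then have "local_degree G C (lo e) e = of_bool (lo e \<in> links)"
    by (simp add: local_degree_def)
  then show ?thesis using local_degree_ends[of e "lo e" "hi e"] lo_hi[OF assms] assms by simp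
qed

text \<open>Each of the four terms is at most 2, and not all equal 2, as \<open>C\<close> would
  otherwise never leave the clique.\<close>

lemma sum_local_degree_less:
  assumes v: "v \<in> verts G" "degree G v = 4"
  shows "(\<Sum>e\<in>incident G v. local_degree G C v e) < 8"
proof -
  have I: "incident G v = {e \<in> edges G. hi e = v}" "card (incident G v) = 4"
    using incident_hi v degree_simple_graph[OF simple] by auto
  have le: "local_degree G C v e \<le> 2" if "e \<in> incident G v" for e
    using local_degree_hi[of e] that I by auto
  obtain e0 where "e0 \<in> incident G v" using ex_incident[OF no_isolated v(1)] .
  then obtain e where e: "e \<in> incident G v" "local_degree G C v e \<noteq> 2"
    using local_degree_not_all_2[of v e0] v by auto
  have "(\<Sum>e\<in>incident G v. local_degree G C v e) < (\<Sum>e\<in>incident G v. 2)"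
    using le e by (intro sum_strict_mono_ex1 finite_incident[OF simple]) (auto intro!: bexI[of _ e] le_neq_trans)
  then show ?thesis using I by simp
qed

text \<open>
  The four edges at \<open>v\<close> have total degree 12 inside their clique. The share of \<open>C\<close> is even and,
  since neither \<open>C\<close> nor \<open>D\<close> can stay inside the clique, strictly between 4 and 8.
\<close>

lemma card_links:
  assumes v: "v \<in> verts G" "degree G v = 4"
  shows "card {e \<in> incident G v. lo e \<in> links} = 2"
proof -
  interpret DC: subdivided_decomposition G D C lo hi by (rule swap_subdivided)
  have I: "incident G v = {e \<in> edges G. hi e = v}" "card (incident G v) = 4"
    using incident_hi v degree_simple_graph[OF simple] by auto
  have fin: "finite (incident G v)" by (rule finite_incident[OF simple])
  have "(\<Sum>e\<in>incident G v. local_degree G C v e + local_degree G D v e) = (\<Sum>e\<in>incident G v. 3)"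
    using local_degree_C_D[of _ v] v by (intro sum.cong) auto
  then have "(\<Sum>e\<in>incident G v. local_degree G C v e) + (\<Sum>e\<in>incident G v. local_degree G D v e) = 12"
    using I by (simp add: sum.distrib)
  then have "4 < (\<Sum>e\<in>incident G v. local_degree G C v e)" "(\<Sum>e\<in>incident G v. local_degree G C v e) < 8"
    using sum_local_degree_less[OF v] DC.sum_local_degree_less[OF v] by linarith+
  moreover have "n = 6" if "even n" "4 < n" "n < 8" for n :: nat
    using that by presburger
  ultimately have "(\<Sum>e\<in>incident G v. local_degree G C v e) = 6"
    using even_local_degree by blast
  \<comment> \<open>Over the four edges at \<open>v\<close> this totals 8; 6 of it lies inside the
    clique, which leaves 2 for the links.\<close>
  moreover have "(\<Sum>e\<in>incident G v. local_degree G C v e + of_bool (lo e \<in> links)) = (\<Sum>e\<in>incident G v. 2)"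
  proof (rule sum.cong)
    fix e assume "e \<in> incident G v"
    then show "local_degree G C v e + of_bool (lo e \<in> links) = 2" using local_degree_hi[of e] I(1) by simp
  qed simp
  ultimately have "(\<Sum>e\<in>incident G v. of_bool (lo e \<in> links)) = (2 :: nat)"
    using I by (simp add: sum.distrib)
  then show ?thesis using fin by (simp add: sum_of_bool_eq Collect_conj_eq)
qed

text \<open>The degrees come from \<open>card_links\<close>. For connectedness, a closed set
  \<open>S\<close> is pulled back to the edges with \<open>hi e \<in> S\<close>: a step of
  \<open>C\<close> inside a clique keeps \<open>hi\<close>, and any other step runs along a
  link.\<close>

lemma hamiltonian_cycle_links: "hamiltonian_cycle G' links"
proof (rule hamiltonian_cycleI[OF wf_contraction])
  show sub: "links \<subseteq> edges G'" by (auto simp: links_def)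
  obtain e where "e \<in> edges G" using edges_nonempty by blast
  then have "hi e \<in> verts G'" using lo_hi[of e] lo_hi_verts[of e] by (auto simp: contraction_def)
  then show "verts G' \<noteq> {}" by blast
  show "(\<Sum>w\<in>links. count (ends G' w) v) = 2" if "v \<in> verts G'" for v
    using sum_count_contraction[OF sub] card_links that by (simp add: contraction_def)
  show "connected_by G' links"
    unfolding connected_by_def
  proof (intro allI impI)
    fix S assume S: "S \<subseteq> verts G'" "S \<noteq> {}"
      and cl: "\<forall>w\<in>links. set_mset (ends G' w) \<inter> S \<noteq> {} \<longrightarrow> set_mset (ends G' w) \<subseteq> S"
    have hi_ex: "\<exists>e\<in>edges G. hi e = v" if "v \<in> verts G'" for v
      using that ex_incident[OF no_isolated, of v] incident_hi[of v] by (auto simp: contraction_def)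
    have "{e \<in> edges G. hi e \<in> S} = edges G"
    proof (rule C_closed)
      show "{e \<in> edges G. hi e \<in> S} \<noteq> {}" using hi_ex S by blast
      fix e f assume ef: "{e, f} \<in> C" "e \<in> {e \<in> edges G. hi e \<in> S}"
      then obtain x where x: "e \<in> incident G x" "f \<in> incident G x" "e \<noteq> f"
        using adjacent_iff[of e f] by blast
      have f: "f \<in> edges G" using x incident_subset by blast
      have e: "e \<in> edges G" "hi e \<in> S" using ef by auto
      have "x = hi e \<or> x = lo e" using x(1) lo_hi[OF e(1)] by (auto simp: incident_def)
      then show "f \<in> {e \<in> edges G. hi e \<in> S}"
      proof
        assume "x = hi e"
        then show ?thesis using x(2) incident_hi[of x] lo_hi[OF e(1)] e(2) by auto
      next
        assume "x = lo e"
        then have I: "incident G (lo e) = {e, f}"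
          using x incident_lo_doubleton[OF e(1)] by (metis insertE singletonD)
        then have "lo e \<in> links" using ef lo_in_edges[OF e(1)] by (simp add: links_def)
        moreover have "ends G' (lo e) = {#hi e, hi f#}" using I x(3) by (simp add: contraction_def)
        ultimately have "hi f \<in> S" using cl e(2) by force
        then show ?thesis using f by simp
      qed
    qed auto
    then show "S = verts G'" using S hi_ex by blast
  qed
qed

text \<open>The pair at each vertex of degree 2 is an edge of \<open>L(G)\<close>, hence in exactly
  one of \<open>C\<close> and \<open>D\<close>.\<close>

lemma decomposes_contraction: "decomposes_into_two_hamiltonian_cycles G'"
proof -
  interpret DC: subdivided_decomposition G D C lo hi by (rule swap_subdivided)
  have "links \<inter> DC.links = {}" using disjoint by (auto simp: links_def DC.links_def)
  moreover have "links \<union> DC.links = edges G'"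
  proof -
    have "incident G w \<in> C \<union> D" if "w \<in> edges G'" for w
    proof -
      have "card (incident G w) = 2"
        using that degree_simple_graph[OF simple, of w] by (simp add: contraction_def)
      then obtain e f where "incident G w = {e, f}" "e \<noteq> f" by (auto simp: card_2_iff)
      then show ?thesis using adjacent_iff[of e f] by auto
    qed
    then show ?thesis by (auto simp: links_def DC.links_def)
  qed
  ultimately show ?thesis
    unfolding decomposes_into_two_hamiltonian_cycles_def
    using hamiltonian_cycle_links DC.hamiltonian_cycle_links by blast
qed

end

section \<open>The classification\<close>

theorem theorem1:
  fixes G :: "('v, 'e) multigraph"
  assumes "simple_graph G"
    and no_isolated: "\<forall>v\<in>verts G. degree G v > 0"
    and "decomposes_into_two_hamiltonian_cycles (line_graph G)"
  shows "isomorphic G (complete_bipartite 1 5) \<or>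
    (\<exists>G' :: ('v, 'v) multigraph. wf_multigraph G' \<and> regular 4 G' \<and>
       decomposes_into_two_hamiltonian_cycles G' \<and> isomorphic G (subdivision G')) \<or>
    (regular 3 G \<and> hamiltonian G)"
proof -
  obtain C D where "line_graph_decomposition G C D"
    using assms(1,3)
    by (auto simp: decomposes_into_two_hamiltonian_cycles_def line_graph_decomposition_def)
  then interpret line_graph_decomposition G C D .
  consider (five) c where "c \<in> verts G" "degree G c = 5"
    | (three) v where "v \<in> verts G" "degree G v = 3"
    | (other) "\<forall>v\<in>verts G. degree G v \<noteq> 5 \<and> degree G v \<noteq> 3"
    by blast
  then show ?thesis
  proof cases
    case five
    then show ?thesis using star[OF no_isolated] by blast
  next
    case three
    then show ?thesis using regular_3[OF no_isolated] cubic_hamiltonian by blast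
  next
    case other
    have "\<exists>w v. e \<in> edges G \<longrightarrow> ends G e = {#w, v#} \<and> degree G w = 2 \<and> degree G v = 4" for e
    proof (cases "e \<in> edges G")
      case True
      then obtain u v where e: "ends G e = {#u, v#}" using simple_graph_edge[OF simple] by metis
      then have "u \<in> verts G" "v \<in> verts G"
        using simple True by (auto simp: simple_graph_def wf_multigraph_def)
      then have "degree G u > 0" "degree G v > 0" "degree G u \<notin> {3, 5}" "degree G v \<notin> {3, 5}"
        using other no_isolated by auto
      \<comment> \<open>With 0, 3 and 5 excluded, the sum 6 also rules out 1 and 6, and only 2 + 4
        is left.\<close>
      then have "degree G u = 2 \<and> degree G v = 4 \<or> degree G u = 4 \<and> degree G v = 2"
        using degree_ends[OF True e] by auto
      then show ?thesis using e by (metis add_mset_commute)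
    qed simp
    then obtain lo hi where "\<And>e. e \<in> edges G \<Longrightarrow>
        ends G e = {#lo e, hi e#} \<and> degree G (lo e) = 2 \<and> degree G (hi e) = 4"
      by metis
    then interpret subdivided_decomposition G C D lo hi
      using no_isolated by unfold_locales
    show ?thesis
      using wf_contraction regular_contraction decomposes_contraction isomorphic_subdivision by blast
  qed
qed

end
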